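(* For any integer $d \geq 1$ and any $s=(s_0,\ldots,s_{d-1}) \in \{-1,0,1\}^d$, there exists a Hilbert polynomial $f(x) \in \mathbb{Z}[x]$ of degree $d$ such that $S(f(x))=s$.
   Context: Let $k$ be a field. Let $R=\bigoplus_{i\ge 0}R_i$ be a finitely generated graded commutative $k$-algebra. Its Hilbert function is $H(R;i):=\dim_k(R_i)$, where $R_i$ is the graded component of $R$ of degree $i$. The algebra $R$ is called standard if it can be finitely generated as a $k$-algebra by elements of $R_1$. If $R$ is standard, there is a (unique) polynomial $P_R(x)\in\mathbb{Q}[x]$ such that $H(R;i)=P_R(i)$ for all sufficiently large integers $i$; $P_R(x)$ is called the Hilbert polynomial of $R$. A polynomial $f(x)\in\mathbb{Q}[x]$ is called a Hilbert polynomial if $f(x)=P_R(x)$ for some standard graded commutative $k$-algebra $R$. The sign function of a real number $x$ is $\mathrm{sgn}(x)=-1$ if $x<0$, $\mathrm{sgn}(x)=0$ if $x=0$, and $\mathrm{sgn}(x)=1$ if $x>0$. For a polynomial $f(x)=\sum_{i=0}^{d}a_ix^i$ of degree $d$, set $S(f(x))=(\mathrm{sgn}(a_0),\ldots,\mathrm{sgn}(a_{d-1}))\in\{-1,0,1\}^d$ (the signs of all coefficients except the leading one). *)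

theory Defs
  imports "Jordan_Normal_Form.Missing_VectorSpace" "HOL-Computational_Algebra.Polynomial"
begin

locale graded_algebra = K: field K + R: algebra K R
  for K :: "('a, 'm) ring_scheme" and R :: "('a, 'b, 'n) module_scheme" (structure) +
  fixes A :: "nat \<Rightarrow> 'b set"
  assumes component_subspace: "VectorSpace.subspace K (A i) R"
    and component_mult: "\<lbrakk>x \<in> A i; y \<in> A j\<rbrakk> \<Longrightarrow> x \<otimes> y \<in> A (i + j)"
    and component_decomp: "x \<in> carrier R \<Longrightarrow>
      \<exists>!c. (\<forall>i. c i \<in> A i) \<and> finite {i. c i \<noteq> \<zero>} \<and> x = (\<Oplus>i\<in>{i. c i \<noteq> \<zero>}. c i)"

inductive_set generate_algebra ::
    "('a, 'm) ring_scheme \<Rightarrow> ('a, 'b, 'n) module_scheme \<Rightarrow> 'b set \<Rightarrow> 'b set"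
  for K and R (structure) and S
where
  one: "\<one> \<in> generate_algebra K R S"
| incl: "x \<in> S \<Longrightarrow> x \<in> generate_algebra K R S"
| add: "\<lbrakk>x \<in> generate_algebra K R S; y \<in> generate_algebra K R S\<rbrakk>
    \<Longrightarrow> x \<oplus> y \<in> generate_algebra K R S"
| mult: "\<lbrakk>x \<in> generate_algebra K R S; y \<in> generate_algebra K R S\<rbrakk>
    \<Longrightarrow> x \<otimes> y \<in> generate_algebra K R S"
| smult: "\<lbrakk>a \<in> carrier K; x \<in> generate_algebra K R S\<rbrakk>
    \<Longrightarrow> a \<odot> x \<in> generate_algebra K R S"

text \<open>
  The constant \<open>vectorspace.dim\<close> is unspecified on infinite-dimensional spaces; the components of
  a standard graded algebra are finite-dimensional.
\<close>

definition hilbert_function ::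
    "('a, 'm) ring_scheme \<Rightarrow> ('a, 'b, 'n) module_scheme \<Rightarrow> (nat \<Rightarrow> 'b set) \<Rightarrow> nat \<Rightarrow> nat"
  where "hilbert_function K R A i = vectorspace.dim K (R\<lparr>carrier := A i\<rparr>)"

locale standard_graded_algebra = graded_algebra +
  assumes standard: "\<exists>S. finite S \<and> S \<subseteq> A 1 \<and> generate_algebra K R S = carrier R"

definition is_hilbert_polynomial_of ::
    "('a, 'm) ring_scheme \<Rightarrow> ('a, 'b, 'n) module_scheme \<Rightarrow> (nat \<Rightarrow> 'b set) \<Rightarrow> rat poly \<Rightarrow> bool"
  where "is_hilbert_polynomial_of K R A f \<longleftrightarrow>
    (\<forall>\<^sub>F i in sequentially. of_nat (hilbert_function K R A i) = poly f (of_nat i))"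

lemma is_hilbert_polynomial_of_unique:
  assumes "is_hilbert_polynomial_of K R A f" "is_hilbert_polynomial_of K R A g"
  shows "f = g"
proof -
  have "\<forall>\<^sub>F i in sequentially. poly (f - g) (of_nat i) = 0"
    using assms unfolding is_hilbert_polynomial_of_def
    by eventually_elim simp
  then obtain N where N: "poly (f - g) (of_nat i) = 0" if "i \<ge> N" for i
    by (auto simp: eventually_sequentially)
  have "infinite ((of_nat :: nat \<Rightarrow> rat) ` {N..})"
    by (simp add: finite_image_iff infinite_Ici)
  moreover have "of_nat ` {N..} \<subseteq> {x. poly (f - g) x = 0}"
    using N by auto
  ultimately have "f - g = 0"
    using poly_roots_finite finite_subset by blast
  then show ?thesis
    by simp
qed

text \<open>
  The existential quantifier over algebras needs a fixed type for their elements. The type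
  \<open>nat multiset \<Rightarrow> 'a\<close> (coefficient families indexed by monomials in countably many variables)
  loses no generality: a standard graded \<open>K\<close>-algebra is isomorphic to some
  \<open>K[x\<^sub>0, \<dots>, x\<^sub>n] / I\<close>, and choosing one representative in each residue class identifies it with an
  algebra whose elements are polynomials. The operations of \<open>R\<close> are arbitrary, and in particular
  need not be pointwise.
\<close>

definition is_hilbert_polynomial :: "('a, 'm) ring_scheme \<Rightarrow> rat poly \<Rightarrow> bool"
  where "is_hilbert_polynomial K f \<longleftrightarrow>
    (\<exists>(R :: ('a, nat multiset \<Rightarrow> 'a) module) A.
      standard_graded_algebra K R A \<and> is_hilbert_polynomial_of K R A f)"

definition sign_vector :: "'a::linordered_idom poly \<Rightarrow> 'a list"
  where "sign_vector f = map (\<lambda>i. sgn (coeff f i)) [0..<degree f]"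

end

theory Submission
  imports Defs "HOL-Library.Product_Plus"
begin

text \<open>
  Sets \<open>M i\<close> of monomials span a graded algebra in which a product of two monomials is their sum in
  the ambient monoid if that lies in some \<open>M k\<close>, and zero otherwise; its Hilbert function is
  \<open>i \<mapsto> card (M i)\<close>. Gluing two such algebras along their degree-zero parts adds Hilbert
  polynomials, and the Segre product multiplies them. The plane curve \<open>z^(2k+3) = 0\<close> has Hilbert
  polynomial \<open>(2k+3)(x - k)\<close>, in particular \<open>3x\<close> for \<open>k = 0\<close>.

  If \<open>f\<close> has degree \<open>n\<close>, leading coefficient \<open>a > 0\<close> and the prescribed signs \<open>s\<^sub>0, \<dots>, s\<^sub>n\<^sub>-\<^sub>1\<close>, take
  \<open>k = a - s\<^sub>n \<ge> 0\<close> and \<open>c = 2k+3\<close>. Then \<open>(3x)^n * c(x - k) + 3^n c f\<close> has degree \<open>n + 1\<close>, coefficient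
  \<open>3^n c s\<^sub>n\<close> at \<open>x^n\<close>, and below that the coefficients of \<open>f\<close> scaled by \<open>3^n c > 0\<close>.
\<close>

section \<open>Sums over dependent pairs\<close>

text \<open>The index set splits into the disjoint fibres over \<open>I\<close>. The additive form
  turns the iterated sum of a threefold product into a single sum in
  \<open>mult3_apply\<close>.\<close>

lemma (in comm_monoid) finprod_Sigma:
  assumes "finite I" "\<And>i. i \<in> I \<Longrightarrow> finite (A i)"
    "\<And>i j. i \<in> I \<Longrightarrow> j \<in> A i \<Longrightarrow> g i j \<in> carrier G"
  shows "(\<Otimes>i\<in>I. \<Otimes>j\<in>A i. g i j) = finprod G (\<lambda>(i, j). g i j) (Sigma I A)"
proof -
  have "finprod G (\<lambda>(i, j). g i j) (Sigma I A) =
      finprod G (\<lambda>(i, j). g i j) (\<Union>i\<in>I. {i} \<times> A i)"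
    by (rule arg_cong[where f = "finprod G _"]) auto
  also have "\<dots> = (\<Otimes>i\<in>I. finprod G (\<lambda>(i, j). g i j) ({i} \<times> A i))"
    using assms by (intro finprod_UN_disjoint) (auto simp: pairwise_def disjnt_def)
  also have "\<dots> = (\<Otimes>i\<in>I. \<Otimes>j\<in>A i. g i j)"
  proof (rule finprod_cong')
    fix i assume "i \<in> I"
    have "finprod G (\<lambda>(i, j). g i j) (Pair i ` A i) = (\<Otimes>j\<in>A i. case (i, j) of (i, j) \<Rightarrow> g i j)"
      using assms \<open>i \<in> I\<close> by (intro finprod_reindex) (auto simp: inj_on_def)
    moreover have "Pair i ` A i = {i} \<times> A i" by auto
    ultimately show "finprod G (\<lambda>(i, j). g i j) ({i} \<times> A i) = (\<Otimes>j\<in>A i. g i j)" by simp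
  qed (use assms in \<open>auto intro!: finprod_closed\<close>)
  finally show ?thesis by simp
qed

lemmas (in abelian_monoid) finsum_Sigma = add.finprod_Sigma

section \<open>Graded sets of monomials\<close>

text \<open>The elements of \<open>M i\<close> are the monomials of degree \<open>i\<close> that are
  nonzero in the algebra. \<open>degree_add\<close> makes nonzero products respect degrees and, for
  \<open>b = 0\<close>, makes the sets \<open>M i\<close> disjoint. \<open>divisor\<close> says that
  a partial product of a nonzero product is nonzero, which gives associativity;
  \<open>generated\<close> gives generation in degree one.\<close>

locale graded_monomials =
  fixes M :: "nat \<Rightarrow> 'x :: comm_monoid_add set"
  assumes degree_0: "M 0 = {0}"
    and finite_degree_1: "finite (M 1)"
    and degree_add: "\<lbrakk>a \<in> M i; b \<in> M j; a + b \<in> M k\<rbrakk> \<Longrightarrow> k = i + j"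
    and divisor: "\<lbrakk>a \<in> M i; b \<in> M j; c \<in> M k; a + b + c \<in> M l\<rbrakk> \<Longrightarrow> a + b \<in> M (i + j)"
    and generated: "m \<in> M (Suc i) \<Longrightarrow> \<exists>a\<in>M 1. \<exists>b\<in>M i. m = a + b"
begin

definition monomials :: "'x set" where "monomials = (\<Union>i. M i)"

definition factorizations :: "'x \<Rightarrow> ('x \<times> 'x) set"
  where "factorizations m = {(a, b). a \<in> monomials \<and> b \<in> monomials \<and> a + b = m}"

definition factorizations3 :: "'x \<Rightarrow> ('x \<times> 'x \<times> 'x) set"
  where "factorizations3 m =
    {(a, b, c). a \<in> monomials \<and> b \<in> monomials \<and> c \<in> monomials \<and> a + b + c = m}"

lemma monomialsI: "m \<in> M i \<Longrightarrow> m \<in> monomials"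
  by (auto simp: monomials_def)

lemma zero_in_monomials [simp]: "0 \<in> monomials"
  using degree_0 by (auto simp: monomials_def)

lemma degree_unique: "\<lbrakk>m \<in> M i; m \<in> M j\<rbrakk> \<Longrightarrow> i = j"
  using degree_add[of m i 0 0 j] degree_0 by simp

lemma finite_degree: "finite (M i)"
proof (induction i)
  case (Suc i)
  have "M (Suc i) \<subseteq> (\<lambda>(a, b). a + b) ` (M 1 \<times> M i)"
    using generated by fastforce
  then show ?case
    using Suc finite_degree_1 finite_subset by blast
qed (simp add: degree_0)

lemma add_divisor:
  assumes "a \<in> monomials" "b \<in> monomials" "c \<in> monomials" "a + b + c \<in> monomials"
  shows "a + b \<in> monomials"
proof -
  obtain i j k l where "a \<in> M i" "b \<in> M j" "c \<in> M k" "a + b + c \<in> M l"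
    using assms by (auto simp: monomials_def)
  then show ?thesis using divisor monomialsI by blast
qed

text \<open>By \<open>degree_add\<close> the degrees of two factors of \<open>m\<close> sum to the
  degree of \<open>m\<close>, so both factors lie in a finite union of finite sets.\<close>

lemma finite_factorizations:
  assumes "m \<in> monomials"
  shows "finite (factorizations m)"
proof -
  obtain k where k: "m \<in> M k" using assms by (auto simp: monomials_def)
  have "factorizations m \<subseteq> (\<Union>i\<le>k. M i) \<times> (\<Union>i\<le>k. M i)"
  proof
    fix p assume "p \<in> factorizations m"
    then obtain a b i j where p: "p = (a, b)" "a \<in> M i" "b \<in> M j" "a + b = m"
      by (auto simp: factorizations_def monomials_def)
    then have "k = i + j" using degree_add k by blast
    then show "p \<in> (\<Union>i\<le>k. M i) \<times> (\<Union>i\<le>k. M i)" using p by auto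
  qed
  then show ?thesis
    using finite_degree by (meson finite_SigmaI finite_UN_I finite_atMost finite_subset)
qed

end

section \<open>The algebra spanned by a graded set of monomials\<close>

locale monomial_algebra = field K + graded_monomials M
  for K :: "('a, 'm) ring_scheme" (structure) and M :: "nat \<Rightarrow> 'x :: comm_monoid_add set"
begin

text \<open>Elements are coefficient functions on the whole ambient monoid, so that
  \<open>'x = nat multiset\<close> yields the element type that \<open>is_hilbert_polynomial\<close>
  asks for. Multiplication is convolution, cut off outside \<open>monomials\<close>.\<close>

definition R :: "('a, 'x \<Rightarrow> 'a) module" where
  "R = \<lparr>carrier = {f. (\<forall>m. f m \<in> carrier K) \<and> finite {m. f m \<noteq> \<zero>} \<and> {m. f m \<noteq> \<zero>} \<subseteq> monomials},
    monoid.mult = (\<lambda>f g m. if m \<in> monomials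
      then finsum K (\<lambda>(a, b). f a \<otimes> g b) (factorizations m) else \<zero>),
    one = (\<lambda>m. if m = 0 then \<one> else \<zero>),
    zero = (\<lambda>m. \<zero>),
    add = (\<lambda>f g m. f m \<oplus> g m),
    module.smult = (\<lambda>c f m. c \<otimes> f m)\<rparr>"

definition A :: "nat \<Rightarrow> ('x \<Rightarrow> 'a) set"
  where "A i = {f \<in> carrier R. \<forall>m. m \<notin> M i \<longrightarrow> f m = \<zero>}"

text \<open>The monomial \<open>a\<close> as an element of the algebra.\<close>

definition \<delta> :: "'x \<Rightarrow> 'x \<Rightarrow> 'a"
  where "\<delta> a = (\<lambda>m. if m = a then \<one> else \<zero>)"

lemma delta_apply: "\<delta> a m = (if m = a then \<one> else \<zero>)"
  by (simp add: \<delta>_def)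

lemma delta_in_carrier [simp]: "\<delta> a m \<in> carrier K"
  by (simp add: \<delta>_def)

lemma mem_carrierD:
  assumes "f \<in> carrier R"
  shows "f m \<in> carrier K" "m \<notin> monomials \<Longrightarrow> f m = \<zero>" "finite {m. f m \<noteq> \<zero>}"
  using assms by (auto simp: R_def)

lemma mem_carrierI:
  assumes "\<And>m. f m \<in> carrier K" "finite S" "S \<subseteq> monomials" "\<And>m. m \<notin> S \<Longrightarrow> f m = \<zero>"
  shows "f \<in> carrier R"
proof -
  have "{m. f m \<noteq> \<zero>} \<subseteq> S" using assms(4) by auto
  then have "finite {m. f m \<noteq> \<zero>}" "{m. f m \<noteq> \<zero>} \<subseteq> monomials"
    using assms(2,3) by (auto intro: finite_subset)
  then show ?thesis using assms(1) unfolding R_def by simp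
qed

lemma R_simps [simp]:
  "\<zero>\<^bsub>R\<^esub> = (\<lambda>m. \<zero>)"
  "\<one>\<^bsub>R\<^esub> = \<delta> 0"
  "f \<oplus>\<^bsub>R\<^esub> g = (\<lambda>m. f m \<oplus> g m)"
  "c \<odot>\<^bsub>R\<^esub> f = (\<lambda>m. c \<otimes> f m)"
  by (simp_all add: R_def \<delta>_def)

lemma mult_apply:
  "(f \<otimes>\<^bsub>R\<^esub> g) m = (if m \<in> monomials
    then finsum K (\<lambda>(a, b). f a \<otimes> g b) (factorizations m) else \<zero>)"
  by (simp add: R_def)

lemma zero_closed_R: "(\<lambda>m. \<zero>) \<in> carrier R"
  by (rule mem_carrierI[where S = "{}"]) auto

lemma delta_closed: "a \<in> monomials \<Longrightarrow> \<delta> a \<in> carrier R"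
  by (rule mem_carrierI[where S = "{a}"]) (auto simp: delta_apply)

lemma add_closed_R:
  assumes "f \<in> carrier R" "g \<in> carrier R"
  shows "(\<lambda>m. f m \<oplus> g m) \<in> carrier R"
  using assms[THEN mem_carrierD(1)] assms[THEN mem_carrierD(2)] assms[THEN mem_carrierD(3)]
  by (intro mem_carrierI[where S = "({m. f m \<noteq> \<zero>} \<union> {m. g m \<noteq> \<zero>})"]) auto

lemma smult_closed_R:
  assumes "c \<in> carrier K" "f \<in> carrier R"
  shows "(\<lambda>m. c \<otimes> f m) \<in> carrier R"
  using assms(1) assms(2)[THEN mem_carrierD(1)] assms(2)[THEN mem_carrierD(2)]
    assms(2)[THEN mem_carrierD(3)]
  by (intro mem_carrierI[where S = "{m. f m \<noteq> \<zero>}"]) auto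

text \<open>The support of a product lies in the set of sums of elements of the two supports, which
  is finite.\<close>

lemma mult_closed_R:
  assumes f: "f \<in> carrier R" and g: "g \<in> carrier R"
  shows "f \<otimes>\<^bsub>R\<^esub> g \<in> carrier R"
proof (rule mem_carrierI)
  let ?S = "(\<lambda>(a, b). a + b) ` ({m. f m \<noteq> \<zero>} \<times> {m. g m \<noteq> \<zero>})"
  note [simp] = mem_carrierD(1)[OF f] mem_carrierD(1)[OF g]
  show "(f \<otimes>\<^bsub>R\<^esub> g) m \<in> carrier K" for m
    by (auto simp: mult_apply intro!: finsum_closed)
  show "finite (?S \<inter> monomials)"
    using mem_carrierD(3)[OF f] mem_carrierD(3)[OF g] by blast
  show "(f \<otimes>\<^bsub>R\<^esub> g) m = \<zero>" if m: "m \<notin> ?S \<inter> monomials" for m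
  proof (cases "m \<in> monomials")
    case True
    have "f a \<otimes> g b = \<zero>" if "(a, b) \<in> factorizations m" for a b
    proof -
      have "a + b = m" using that by (auto simp: factorizations_def)
      then have "f a = \<zero> \<or> g b = \<zero>" using m True by force
      then show ?thesis by auto
    qed
    then have "finsum K (\<lambda>(a, b). f a \<otimes> g b) (factorizations m) = \<zero>"
      by (intro add.finprod_one_eqI) auto
    then show ?thesis by (simp add: mult_apply)
  qed (simp add: mult_apply)
qed auto

lemma mult_comm_R:
  assumes f: "f \<in> carrier R" and g: "g \<in> carrier R"
  shows "f \<otimes>\<^bsub>R\<^esub> g = g \<otimes>\<^bsub>R\<^esub> f"
proof
  fix m
  note [simp] = mem_carrierD(1)[OF f] mem_carrierD(1)[OF g]
  have "finsum K (\<lambda>(a, b). f a \<otimes> g b) (factorizations m) =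
      finsum K (\<lambda>(a, b). g a \<otimes> f b) (factorizations m)"
    by (rule finsum_reindex_bij_witness[where i = prod.swap and j = prod.swap])
      (auto simp: factorizations_def add.commute m_comm)
  then show "(f \<otimes>\<^bsub>R\<^esub> g) m = (g \<otimes>\<^bsub>R\<^esub> f) m" by (simp add: mult_apply)
qed

text \<open>Truncating the product to \<open>monomials\<close> loses no term of a threefold product by \<open>add_divisor\<close>.\<close>

lemma mult3_apply:
  assumes f: "f \<in> carrier R" and g: "g \<in> carrier R" and h: "h \<in> carrier R" and m: "m \<in> monomials"
  shows "((f \<otimes>\<^bsub>R\<^esub> g) \<otimes>\<^bsub>R\<^esub> h) m =
    finsum K (\<lambda>(a, b, c). f a \<otimes> g b \<otimes> h c) (factorizations3 m)"
proof -
  note [simp] = mem_carrierD(1)[OF f] mem_carrierD(1)[OF g] mem_carrierD(1)[OF h]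
  have fin: "finite (factorizations p)" if "(p, c) \<in> factorizations m" for p c
    using that by (intro finite_factorizations) (auto simp: factorizations_def)
  have "((f \<otimes>\<^bsub>R\<^esub> g) \<otimes>\<^bsub>R\<^esub> h) m =
      (\<Oplus>q\<in>factorizations m. finsum K (\<lambda>(a, b). f a \<otimes> g b \<otimes> h (snd q)) (factorizations (fst q)))"
    unfolding mult_apply[of "f \<otimes>\<^bsub>R\<^esub> g"] if_P[OF m]
  proof (rule finsum_cong')
    fix q assume q: "q \<in> factorizations m"
    obtain p c where [simp]: "q = (p, c)" by (cases q)
    have "p \<in> monomials" using q by (auto simp: factorizations_def)
    then have "(f \<otimes>\<^bsub>R\<^esub> g) p \<otimes> h c = (\<Oplus>r\<in>factorizations p. (case r of (a, b) \<Rightarrow> f a \<otimes> g b) \<otimes> h c)"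
      using fin q by (simp add: mult_apply) (rule finsum_ldistr, auto)
    then show "(case q of (p, c) \<Rightarrow> (f \<otimes>\<^bsub>R\<^esub> g) p \<otimes> h c) =
        finsum K (\<lambda>(a, b). f a \<otimes> g b \<otimes> h (snd q)) (factorizations (fst q))"
      by (simp add: case_prod_unfold)
  qed (auto intro!: finsum_closed)
  also have "\<dots> = finsum K (\<lambda>(q, a, b). f a \<otimes> g b \<otimes> h (snd q))
      (SIGMA q:factorizations m. factorizations (fst q))"
    using fin finite_factorizations[OF m]
    by (subst finsum_Sigma) (auto simp: case_prod_unfold)
  also have "\<dots> = finsum K (\<lambda>(a, b, c). f a \<otimes> g b \<otimes> h c) (factorizations3 m)"
    by (rule finsum_reindex_bij_witness[where i = "\<lambda>(a, b, c). ((a + b, c), a, b)"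
          and j = "\<lambda>((p, c), a, b). (a, b, c)"])
      (use m in \<open>auto simp: factorizations_def factorizations3_def intro: add_divisor\<close>)
  finally show ?thesis .
qed

text \<open>The sum over threefold factorizations is invariant under cyclic rotation of the factors,
  so \<open>(f g) h\<close> equals \<open>(g h) f\<close>; commutativity does the rest.\<close>

lemma mult_assoc_R:
  assumes f: "f \<in> carrier R" and g: "g \<in> carrier R" and h: "h \<in> carrier R"
  shows "(f \<otimes>\<^bsub>R\<^esub> g) \<otimes>\<^bsub>R\<^esub> h = f \<otimes>\<^bsub>R\<^esub> (g \<otimes>\<^bsub>R\<^esub> h)"
proof
  fix m
  note [simp] = mem_carrierD(1)[OF f] mem_carrierD(1)[OF g] mem_carrierD(1)[OF h]
  show "((f \<otimes>\<^bsub>R\<^esub> g) \<otimes>\<^bsub>R\<^esub> h) m = (f \<otimes>\<^bsub>R\<^esub> (g \<otimes>\<^bsub>R\<^esub> h)) m"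
  proof (cases "m \<in> monomials")
    case True
    have "((f \<otimes>\<^bsub>R\<^esub> g) \<otimes>\<^bsub>R\<^esub> h) m = ((g \<otimes>\<^bsub>R\<^esub> h) \<otimes>\<^bsub>R\<^esub> f) m"
      unfolding mult3_apply[OF f g h True] mult3_apply[OF g h f True]
      by (rule finsum_reindex_bij_witness[where j = "\<lambda>(a, b, c). (b, c, a)"
            and i = "\<lambda>(b, c, a). (a, b, c)"]) (auto simp: factorizations3_def m_ac add_ac)
    then show ?thesis using mult_comm_R[OF f mult_closed_R[OF g h]] by simp
  qed (simp add: mult_apply)
qed

lemma finsum_delta:
  assumes "finite S" "x \<in> S" "\<And>y. y \<in> S \<Longrightarrow> y \<noteq> x \<Longrightarrow> g y = \<zero>" "g x \<in> carrier K"
  shows "(\<Oplus>y\<in>S. g y) = g x"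
proof -
  have "g y \<in> carrier K" if "y \<in> S" for y
    using assms that by (cases "y = x") auto
  then have "(\<Oplus>y\<in>S. g y) = (\<Oplus>y\<in>{x}. g y)"
    using assms by (intro add.finprod_mono_neutral_cong_right) auto
  also have "\<dots> = g x" using assms by simp
  finally show ?thesis .
qed

lemma delta_mult_delta:
  assumes "a \<in> monomials" "b \<in> monomials"
  shows "\<delta> a \<otimes>\<^bsub>R\<^esub> \<delta> b = (if a + b \<in> monomials then \<delta> (a + b) else \<zero>\<^bsub>R\<^esub>)"
proof
  fix m
  have "finsum K (\<lambda>(x, y). \<delta> a x \<otimes> \<delta> b y) (factorizations m) = (if m = a + b then \<one> else \<zero>)"
    if m: "m \<in> monomials"
  proof (cases "m = a + b")
    case True
    then have "finsum K (\<lambda>(x, y). \<delta> a x \<otimes> \<delta> b y) (factorizations m) =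
        (case (a, b) of (x, y) \<Rightarrow> \<delta> a x \<otimes> \<delta> b y)"
      using assms finite_factorizations[OF m]
      by (intro finsum_delta) (auto simp: factorizations_def delta_apply split: if_splits)
    then show ?thesis using True by (simp add: delta_apply)
  next
    case False
    then show ?thesis
      by (auto simp: factorizations_def delta_apply intro!: add.finprod_one_eqI)
  qed
  then show "(\<delta> a \<otimes>\<^bsub>R\<^esub> \<delta> b) m = (if a + b \<in> monomials then \<delta> (a + b) else \<zero>\<^bsub>R\<^esub>) m"
    by (auto simp: mult_apply delta_apply)
qed

lemma one_mult_R:
  assumes f: "f \<in> carrier R"
  shows "\<delta> 0 \<otimes>\<^bsub>R\<^esub> f = f"
proof
  fix m
  note [simp] = mem_carrierD(1)[OF f]
  have "finsum K (\<lambda>(x, y). \<delta> 0 x \<otimes> f y) (factorizations m) = f m" if m: "m \<in> monomials"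
  proof -
    have "finsum K (\<lambda>(x, y). \<delta> 0 x \<otimes> f y) (factorizations m) =
        (case (0, m) of (x, y) \<Rightarrow> \<delta> 0 x \<otimes> f y)"
      using m finite_factorizations[OF m]
      by (intro finsum_delta) (auto simp: factorizations_def delta_apply split: if_splits)
    then show ?thesis by (simp add: delta_apply)
  qed
  then show "(\<delta> 0 \<otimes>\<^bsub>R\<^esub> f) m = f m"
    using mem_carrierD(2)[OF f] by (auto simp: mult_apply)
qed

lemma mult_distrib_R:
  assumes f: "f \<in> carrier R" and g: "g \<in> carrier R" and h: "h \<in> carrier R"
  shows "(f \<oplus>\<^bsub>R\<^esub> g) \<otimes>\<^bsub>R\<^esub> h = f \<otimes>\<^bsub>R\<^esub> h \<oplus>\<^bsub>R\<^esub> g \<otimes>\<^bsub>R\<^esub> h"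
proof
  fix m
  note [simp] = mem_carrierD(1)[OF f] mem_carrierD(1)[OF g] mem_carrierD(1)[OF h]
  show "((f \<oplus>\<^bsub>R\<^esub> g) \<otimes>\<^bsub>R\<^esub> h) m = (f \<otimes>\<^bsub>R\<^esub> h \<oplus>\<^bsub>R\<^esub> g \<otimes>\<^bsub>R\<^esub> h) m"
    by (simp add: mult_apply case_prod_unfold l_distr finsum_addf Pi_def)
qed

lemma smult_mult_R:
  assumes c: "c \<in> carrier K" and f: "f \<in> carrier R" and g: "g \<in> carrier R"
  shows "(c \<odot>\<^bsub>R\<^esub> f) \<otimes>\<^bsub>R\<^esub> g = c \<odot>\<^bsub>R\<^esub> (f \<otimes>\<^bsub>R\<^esub> g)"
proof
  fix m
  note [simp] = mem_carrierD(1)[OF f] mem_carrierD(1)[OF g]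
  show "((c \<odot>\<^bsub>R\<^esub> f) \<otimes>\<^bsub>R\<^esub> g) m = (c \<odot>\<^bsub>R\<^esub> (f \<otimes>\<^bsub>R\<^esub> g)) m"
    using c finite_factorizations[of m]
    by (simp add: mult_apply case_prod_unfold m_assoc finsum_rdistr Pi_def)
qed

lemma abelian_group_R: "abelian_group R"
proof (rule abelian_groupI)
  fix f assume f: "f \<in> carrier R"
  show "\<exists>g\<in>carrier R. g \<oplus>\<^bsub>R\<^esub> f = \<zero>\<^bsub>R\<^esub>"
    \<comment> \<open>The additive inverse is written as \<open>-1\<close> times \<open>f\<close>,
      so that its closure is an instance of closure under scalars.\<close>
    using smult_closed_R[of "\<ominus> \<one>" f] f mem_carrierD(1)[OF f]
    by (intro bexI[of _ "\<lambda>m. \<ominus> \<one> \<otimes> f m"]) (auto simp: l_minus l_neg)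
qed (auto intro!: ext a_assoc a_comm simp: add_closed_R zero_closed_R mem_carrierD(1))

lemma cring_R: "cring R"
proof (rule cringI[OF abelian_group_R])
  show "comm_monoid R"
    by (rule comm_monoidI)
      (auto intro: mult_assoc_R mult_comm_R simp: mult_closed_R one_mult_R delta_closed)
qed (rule mult_distrib_R)

sublocale R: algebra K R
  by (rule algebraI[OF is_cring cring_R])
    (simp_all add: smult_closed_R smult_mult_R[simplified] l_distr r_distr m_assoc mem_carrierD(1))

section \<open>The grading and the dimensions of its components\<close>

lemma vectorspace_R: "vectorspace K R"
  by (intro vectorspace.intro R.module field_axioms)

lemma component_closed: "f \<in> A i \<Longrightarrow> f \<in> carrier R"
  by (simp add: A_def)

lemma subspace_A: "VectorSpace.subspace K (A i) R"
  by (intro VectorSpace.subspace.intro submodule.intro vectorspace_R R.module)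
    (auto simp: A_def add_closed_R smult_closed_R zero_closed_R)

text \<open>Evaluation at \<open>m\<close> is additive. Over an infinite \<open>S\<close> both sums
  take the default value zero.\<close>

lemma finsum_R_apply:
  assumes "g \<in> S \<rightarrow> carrier R"
  shows "(\<Oplus>\<^bsub>R\<^esub>v\<in>S. g v) m = (\<Oplus>v\<in>S. g v m)"
  using assms
proof (induction S rule: infinite_finite_induct)
  case (insert x S)
  then have "(\<Oplus>\<^bsub>R\<^esub>v\<in>insert x S. g v) = g x \<oplus>\<^bsub>R\<^esub> (\<Oplus>\<^bsub>R\<^esub>v\<in>S. g v)"
    by (intro R.M.finsum_insert) auto
  then have "(\<Oplus>\<^bsub>R\<^esub>v\<in>insert x S. g v) m = g x m \<oplus> (\<Oplus>v\<in>S. g v m)"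
    using insert by auto
  also have "\<dots> = (\<Oplus>v\<in>insert x S. g v m)"
    using insert by (subst finsum_insert) (auto dest: mem_carrierD(1))
  finally show ?case .
qed auto

text \<open>A monomial has only one degree, so at \<open>m\<close> of degree \<open>k\<close> every
  component other than \<open>c k\<close> vanishes. Both existence and uniqueness of the
  decomposition rest on this.\<close>

lemma component_sum_apply:
  assumes c: "\<And>i. c i \<in> A i" and I: "finite I" and m: "m \<in> M k"
  shows "(\<Oplus>\<^bsub>R\<^esub>i\<in>I. c i) m = (if k \<in> I then c k m else \<zero>)"
proof -
  have carrier: "c i \<in> carrier R" for i
    using c component_closed by blast
  have other: "c i m = \<zero>" if "i \<noteq> k" for i
    using c[of i] degree_unique m that by (auto simp: A_def)
  have "(\<Oplus>\<^bsub>R\<^esub>i\<in>I. c i) m = (\<Oplus>i\<in>I. c i m)"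
    using carrier by (simp add: finsum_R_apply)
  also have "\<dots> = (if k \<in> I then c k m else \<zero>)"
  proof (cases "k \<in> I")
    case True
    then show ?thesis
      using finsum_delta[OF I, of k "\<lambda>i. c i m"] other mem_carrierD(1)[OF carrier] by auto
  next
    case False
    then have "(\<Oplus>i\<in>I. c i m) = \<zero>"
      using other by (intro add.finprod_one_eqI) metis
    with False show ?thesis by simp
  qed
  finally show ?thesis .
qed

lemma decomposition:
  assumes x: "x \<in> carrier R"
  shows "\<exists>!c. (\<forall>i. c i \<in> A i) \<and> finite {i. c i \<noteq> \<zero>\<^bsub>R\<^esub>} \<and>
    x = (\<Oplus>\<^bsub>R\<^esub>i\<in>{i. c i \<noteq> \<zero>\<^bsub>R\<^esub>}. c i)"
proof (rule ex1I)
  \<comment> \<open>The component of degree \<open>i\<close> is the restriction of \<open>x\<close>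
    to the monomials of that degree.\<close>
  define c where "c = (\<lambda>i m. if m \<in> M i then x m else \<zero>)"
  have cA: "c i \<in> A i" for i
  proof -
    have "c i \<in> carrier R"
      using mem_carrierD[OF x]
      by (intro mem_carrierI[where S = "{m. x m \<noteq> \<zero>}"]) (auto simp: c_def)
    then show ?thesis by (simp add: A_def c_def)
  qed
  \<comment> \<open>Each monomial in the finite support of \<open>x\<close> has at most one degree,
    so only finitely many restrictions are nonzero.\<close>
  have "finite {i. m \<in> M i}" for m
  proof (cases "m \<in> monomials")
    case True
    then obtain k where "m \<in> M k" by (auto simp: monomials_def)
    then have "{i. m \<in> M i} = {k}" using degree_unique by auto
    then show ?thesis by simp
  qed (auto simp: monomials_def)
  then have "finite (\<Union>m\<in>{m. x m \<noteq> \<zero>}. {i. m \<in> M i})"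
    using mem_carrierD(3)[OF x] by blast
  moreover have "{i. c i \<noteq> \<zero>\<^bsub>R\<^esub>} \<subseteq> (\<Union>m\<in>{m. x m \<noteq> \<zero>}. {i. m \<in> M i})"
    by (auto simp: c_def fun_eq_iff split: if_splits)
  ultimately have fin: "finite {i. c i \<noteq> \<zero>\<^bsub>R\<^esub>}" by (rule rev_finite_subset)
  have "x = (\<Oplus>\<^bsub>R\<^esub>i\<in>{i. c i \<noteq> \<zero>\<^bsub>R\<^esub>}. c i)"
  proof
    fix m
    show "x m = (\<Oplus>\<^bsub>R\<^esub>i\<in>{i. c i \<noteq> \<zero>\<^bsub>R\<^esub>}. c i) m"
    proof (cases "m \<in> monomials")
      case True
      then obtain k where k: "m \<in> M k" by (auto simp: monomials_def)
      then show ?thesis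
        unfolding component_sum_apply[OF cA fin k] by (auto simp: c_def fun_eq_iff)
    next
      case False
      have "(\<Oplus>\<^bsub>R\<^esub>i\<in>{i. c i \<noteq> \<zero>\<^bsub>R\<^esub>}. c i) \<in> carrier R"
        using cA component_closed by (intro R.M.finsum_closed) blast
      then show ?thesis using False x by (simp add: mem_carrierD(2))
    qed
  qed
  with cA fin show "(\<forall>i. c i \<in> A i) \<and> finite {i. c i \<noteq> \<zero>\<^bsub>R\<^esub>} \<and>
      x = (\<Oplus>\<^bsub>R\<^esub>i\<in>{i. c i \<noteq> \<zero>\<^bsub>R\<^esub>}. c i)"
    by blast
  fix c' assume c': "(\<forall>i. c' i \<in> A i) \<and> finite {i. c' i \<noteq> \<zero>\<^bsub>R\<^esub>} \<and>
    x = (\<Oplus>\<^bsub>R\<^esub>i\<in>{i. c' i \<noteq> \<zero>\<^bsub>R\<^esub>}. c' i)"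
  show "c' = c"
  proof (intro ext)
    fix k m
    show "c' k m = c k m"
    proof (cases "m \<in> M k")
      case True
      have "x m = (if c' k \<noteq> \<zero>\<^bsub>R\<^esub> then c' k m else \<zero>)"
        using component_sum_apply[of c' "{i. c' i \<noteq> \<zero>\<^bsub>R\<^esub>}", OF _ _ True] c' by simp
      with True show ?thesis by (auto simp: c_def split: if_splits)
    next
      case False
      then show ?thesis using c' by (auto simp: A_def c_def)
    qed
  qed
qed

text \<open>A nonzero term at \<open>m\<close> needs factors from \<open>M i\<close> and
  \<open>M j\<close>, and then \<open>degree_add\<close> forces \<open>m\<close> to have degree
  \<open>i + j\<close>.\<close>

lemma component_mult:
  assumes x: "x \<in> A i" and y: "y \<in> A j"
  shows "x \<otimes>\<^bsub>R\<^esub> y \<in> A (i + j)"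
proof -
  have "(x \<otimes>\<^bsub>R\<^esub> y) m = \<zero>" if m: "m \<notin> M (i + j)" for m
  proof (cases "m \<in> monomials")
    case True
    then obtain k where k: "m \<in> M k" by (auto simp: monomials_def)
    have "x a \<otimes> y b = \<zero>" if "(a, b) \<in> factorizations m" for a b
    proof -
      have "a \<notin> M i \<or> b \<notin> M j"
        using degree_add k m that by (auto simp: factorizations_def)
      then have "x a = \<zero> \<or> y b = \<zero>" using x y by (auto simp: A_def)
      then show ?thesis
        using mem_carrierD(1) component_closed x y by auto
    qed
    then have "finsum K (\<lambda>(a, b). x a \<otimes> y b) (factorizations m) = \<zero>"
      by (intro add.finprod_one_eqI) auto
    then show ?thesis by (simp add: mult_apply)
  qed (simp add: mult_apply)
  then show ?thesis
    using mult_closed_R x y by (auto simp: A_def)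
qed

lemma delta_inject [simp]: "\<delta> a = \<delta> b \<longleftrightarrow> a = b"
  unfolding \<delta>_def fun_eq_iff by (metis one_not_zero)

text \<open>Coefficients in \<open>lincomb\<close> are indexed by vectors, so the coefficient of the
  monomial \<open>m\<close> is \<open>a (\<delta> m)\<close>. Linear independence of the monomials
  can be read off from this formula.\<close>

lemma lincomb_delta:
  assumes S: "finite S" "S \<subseteq> monomials" and a: "a \<in> \<delta> ` S \<rightarrow> carrier K"
  shows "R.lincomb a (\<delta> ` S) = (\<lambda>m. if m \<in> S then a (\<delta> m) else \<zero>)"
proof
  fix m
  have [simp]: "a (\<delta> s) \<in> carrier K" if "s \<in> S" for s
    using a that by auto
  have "R.lincomb a (\<delta> ` S) = (\<Oplus>\<^bsub>R\<^esub>s\<in>S. a (\<delta> s) \<odot>\<^bsub>R\<^esub> \<delta> s)"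
    unfolding R.lincomb_def
    by (rule R.M.finsum_reindex) (use S a delta_closed in \<open>auto simp: inj_on_def intro!: smult_closed_R\<close>)
  then have "R.lincomb a (\<delta> ` S) m = (\<Oplus>s\<in>S. a (\<delta> s) \<otimes> \<delta> s m)"
    using S a delta_closed by (simp only:) (subst finsum_R_apply, auto intro!: smult_closed_R)
  also have "\<dots> = (if m \<in> S then a (\<delta> m) else \<zero>)"
  proof (cases "m \<in> S")
    case True
    have "(\<Oplus>s\<in>S. a (\<delta> s) \<otimes> \<delta> s m) = a (\<delta> m) \<otimes> \<delta> m m"
      using S True by (intro finsum_delta) (auto simp: delta_apply)
    then show ?thesis using True by (auto simp: delta_apply)
  next
    case False
    then have "(\<Oplus>s\<in>S. a (\<delta> s) \<otimes> \<delta> s m) = \<zero>"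
      by (intro add.finprod_one_eqI) (auto simp: delta_apply)
    then show ?thesis using False by simp
  qed
  finally show "R.lincomb a (\<delta> ` S) m = (if m \<in> S then a (\<delta> m) else \<zero>)" .
qed

text \<open>Since \<open>lincomb\<close> indexes coefficients by vectors,
  \<open>the_inv \<delta>\<close> is used to recover the monomial from its basis vector.\<close>

lemma lincomb_coefficients:
  assumes f: "f \<in> carrier R" and S: "finite S" "S \<subseteq> monomials" and zero: "\<And>m. m \<notin> S \<Longrightarrow> f m = \<zero>"
  shows "f = R.lincomb (\<lambda>v. f (the_inv \<delta> v)) (\<delta> ` S)"
proof -
  have [simp]: "the_inv \<delta> (\<delta> m) = m" for m
    by (rule the_inv_f_f) (simp add: inj_def)
  show ?thesis
    using mem_carrierD(1)[OF f] zero by (subst lincomb_delta[OF S]) auto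
qed

text \<open>The monomials of degree \<open>i\<close> form a basis of \<open>A i\<close>.\<close>

lemma dim_component: "vectorspace.dim K (R\<lparr>carrier := A i\<rparr>) = card (M i)"
proof -
  interpret V: vectorspace K R by (rule vectorspace_R)
  interpret Ai: vectorspace K "R\<lparr>carrier := A i\<rparr>"
    by (rule V.subspace_is_vs[OF subspace_A])
  have M: "finite (M i)" "M i \<subseteq> monomials"
    using finite_degree monomialsI by auto
  have sub: "submodule K (A i) R"
    using subspace_A V.is_module by blast
  have delta: "\<delta> ` M i \<subseteq> A i"
    using M delta_closed by (auto simp: A_def delta_apply)
  have carrier: "\<delta> ` M i \<subseteq> carrier R"
    using delta component_closed by blast
  \<comment> \<open>Span and linear independence inside \<open>A i\<close> agree with those in
    \<open>R\<close>, where they are computed below.\<close>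
  note dep = R.span_li_not_depend[OF delta sub]
  have "R.lin_indpt (\<delta> ` M i)"
  proof (rule R.finite_lin_indpt2)
    fix a assume a: "a \<in> \<delta> ` M i \<rightarrow> carrier K" "R.lincomb a (\<delta> ` M i) = \<zero>\<^bsub>R\<^esub>"
    show "\<forall>v\<in>\<delta> ` M i. a v = \<zero>"
      using a(2) unfolding lincomb_delta[OF M a(1)] by (auto simp: fun_eq_iff split: if_splits)
  qed (use M carrier in auto)
  moreover have "R.span (\<delta> ` M i) = A i"
  proof
    show "R.span (\<delta> ` M i) \<subseteq> A i"
      by (rule R.span_is_subset[OF delta sub])
    show "A i \<subseteq> R.span (\<delta> ` M i)"
    proof
      fix f assume f: "f \<in> A i"
      have "f = R.lincomb (\<lambda>v. f (the_inv \<delta> v)) (\<delta> ` M i)"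
        using f M by (intro lincomb_coefficients) (auto simp: A_def)
      then show "f \<in> R.span (\<delta> ` M i)"
        using M mem_carrierD(1)[OF component_closed[OF f]] unfolding R.span_def by blast
    qed
  qed
  ultimately have "Ai.basis (\<delta> ` M i)"
    using dep delta by (simp add: Ai.basis_def)
  then have "Ai.dim = card (\<delta> ` M i)"
    using M by (intro Ai.dim_basis) auto
  then show ?thesis by (simp add: card_image inj_on_def)
qed

section \<open>Generation in degree one\<close>

text \<open>By induction on the degree, a factor of degree one is split off. The product of the two
  factors does not vanish, because their sum is the monomial \<open>m\<close>.\<close>

lemma delta_generated:
  assumes "m \<in> M i"
  shows "\<delta> m \<in> generate_algebra K R (\<delta> ` M 1)"
  using assms
proof (induction i arbitrary: m)
  case 0
  then show ?case
    using generate_algebra.one[of R K] degree_0 by simp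
next
  case (Suc i)
  then obtain a b where ab: "a \<in> M 1" "b \<in> M i" "m = a + b"
    using generated by blast
  have "\<delta> a \<otimes>\<^bsub>R\<^esub> \<delta> b \<in> generate_algebra K R (\<delta> ` M 1)"
    using ab Suc.IH by (blast intro: generate_algebra.mult generate_algebra.incl)
  also have "\<delta> a \<otimes>\<^bsub>R\<^esub> \<delta> b = \<delta> m"
    using ab Suc.prems monomialsI by (subst delta_mult_delta) auto
  finally show ?case .
qed

lemma generated_closed: "generate_algebra K R (\<delta> ` M 1) \<subseteq> carrier R"
proof
  fix x assume "x \<in> generate_algebra K R (\<delta> ` M 1)"
  then show "x \<in> carrier R"
    by induction (auto intro: delta_closed monomialsI simp del: R_simps)
qed

lemma lincomb_generated:
  assumes "finite B" "B \<subseteq> generate_algebra K R (\<delta> ` M 1)" "a \<in> B \<rightarrow> carrier K"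
  shows "R.lincomb a B \<in> generate_algebra K R (\<delta> ` M 1)" (is "_ \<in> ?G")
  using assms
proof (induction B)
  case empty
  \<comment> \<open>The rules of \<open>generate_algebra\<close> produce the zero element as the
    scalar zero times the unit.\<close>
  have "\<zero> \<odot>\<^bsub>R\<^esub> \<one>\<^bsub>R\<^esub> \<in> ?G"
    by (intro generate_algebra.intros) auto
  then show ?case by (simp add: R.lincomb_def)
next
  case (insert v B)
  then have "R.lincomb a (insert v B) = a v \<odot>\<^bsub>R\<^esub> v \<oplus>\<^bsub>R\<^esub> R.lincomb a B"
    unfolding R.lincomb_def using generated_closed
    by (intro R.M.finsum_insert) (auto intro!: R.smult_closed simp del: R_simps)
  with insert show ?case
    by (auto intro!: generate_algebra.add generate_algebra.smult simp del: R_simps)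
qed

lemma carrier_generated: "generate_algebra K R (\<delta> ` M 1) = carrier R" (is "?G = _")
proof
  show "carrier R \<subseteq> ?G"
  proof
    fix f assume f: "f \<in> carrier R"
    define S where "S = {m. f m \<noteq> \<zero>}"
    have S: "finite S" "S \<subseteq> monomials"
      using mem_carrierD(2,3)[OF f] by (auto simp: S_def)
    have G: "\<delta> ` S \<subseteq> ?G"
      using S delta_generated by (auto simp: monomials_def)
    have "f = R.lincomb (\<lambda>v. f (the_inv \<delta> v)) (\<delta> ` S)"
      by (rule lincomb_coefficients[OF f S]) (simp add: S_def)
    also have "\<dots> \<in> ?G"
      using S G mem_carrierD(1)[OF f] by (intro lincomb_generated) auto
    finally show "f \<in> ?G" .
  qed
qed (rule generated_closed)

lemma standard_graded_algebra_R: "standard_graded_algebra K R A"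
proof (intro standard_graded_algebra.intro graded_algebra.intro
    graded_algebra_axioms.intro standard_graded_algebra_axioms.intro)
  show "\<exists>S. finite S \<and> S \<subseteq> A 1 \<and> generate_algebra K R S = carrier R"
    using finite_degree_1 carrier_generated delta_closed monomialsI
    by (intro exI[of _ "\<delta> ` M 1"]) (auto simp: A_def delta_apply)
qed (simp_all add: subspace_A component_mult decomposition field_axioms R.algebra_axioms del: R_simps)

end

section \<open>Realizable polynomials and their closure properties\<close>

text \<open>The Hilbert polynomials of monomial algebras, in a purely combinatorial form that does
  not mention the field: one family \<open>M\<close> serves every \<open>K\<close>.\<close>

definition realizable :: "int poly \<Rightarrow> bool" where
  "realizable f \<longleftrightarrow> (\<exists>M :: nat \<Rightarrow> nat multiset set. graded_monomials M \<and>
    (\<forall>\<^sub>F i in sequentially. int (card (M i)) = poly f (int i)))"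

lemma poly_map_poly_of_int: "poly (map_poly of_int f) (of_int x) = (of_int (poly f x) :: 'a :: comm_ring_1)"
  by (induction f) (simp_all add: map_poly_pCons)

lemma realizable_imp_is_hilbert_polynomial:
  fixes K :: "('a, 'm) ring_scheme"
  assumes "field K" "realizable f"
  shows "is_hilbert_polynomial K (map_poly rat_of_int f)"
proof -
  obtain M :: "nat \<Rightarrow> nat multiset set" where M: "graded_monomials M"
    and f: "\<forall>\<^sub>F i in sequentially. int (card (M i)) = poly f (int i)"
    using assms(2) by (auto simp: realizable_def)
  interpret monomial_algebra K M
    by (intro monomial_algebra.intro assms(1) M)
  have "rat_of_nat (card (M i)) = poly (map_poly rat_of_int f) (of_nat i)"
    if "int (card (M i)) = poly f (int i)" for i
    using poly_map_poly_of_int[of f "int i", where ?'a = rat] that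
    by (metis of_int_of_nat_eq)
  then have "is_hilbert_polynomial_of K R A (map_poly rat_of_int f)"
    unfolding is_hilbert_polynomial_of_def hilbert_function_def dim_component
    using f by (auto elim: eventually_mono)
  then show ?thesis
    using standard_graded_algebra_R unfolding is_hilbert_polynomial_def by blast
qed

text \<open>An injective monoid homomorphism preserves the axioms and the cardinalities.
  Constructions may therefore use any monoid that embeds into \<open>nat multiset\<close>, the type
  fixed by \<open>realizable\<close>.\<close>

lemma realizable_transport:
  fixes M :: "nat \<Rightarrow> 'x :: comm_monoid_add set" and \<phi> :: "'x \<Rightarrow> nat multiset"
  assumes "graded_monomials M" and inj: "inj \<phi>"
    and add: "\<And>a b. \<phi> (a + b) = \<phi> a + \<phi> b" and zero: "\<phi> 0 = 0"
    and f: "\<forall>\<^sub>F i in sequentially. int (card (M i)) = poly f (int i)"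
  shows "realizable f"
proof -
  interpret graded_monomials M by fact
  have mem: "\<phi> a \<in> \<phi> ` M i \<longleftrightarrow> a \<in> M i" for a i
    using inj by (auto simp: inj_def)
  have "graded_monomials (\<lambda>i. \<phi> ` M i)"
  proof
    fix i j k l a b c
    show "k = i + j" if *: "a \<in> \<phi> ` M i" "b \<in> \<phi> ` M j" "a + b \<in> \<phi> ` M k"
    proof -
      obtain x y where "a = \<phi> x" "b = \<phi> y" using *(1,2) by auto
      with * show ?thesis using degree_add[of x i y j k] by (simp add: mem flip: add)
    qed
    show "a + b \<in> \<phi> ` M (i + j)"
      if *: "a \<in> \<phi> ` M i" "b \<in> \<phi> ` M j" "c \<in> \<phi> ` M k" "a + b + c \<in> \<phi> ` M l"
    proof -
      obtain x y z where "a = \<phi> x" "b = \<phi> y" "c = \<phi> z" using *(1-3) by auto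
      with * show ?thesis using divisor[of x i y j z k l] by (simp add: mem flip: add)
    qed
  next
    fix i m assume "m \<in> \<phi> ` M (Suc i)"
    then obtain x where x: "x \<in> M (Suc i)" "m = \<phi> x" by auto
    then obtain a b where "a \<in> M 1" "b \<in> M i" "x = a + b" using generated by blast
    with x show "\<exists>a\<in>\<phi> ` M 1. \<exists>b\<in>\<phi> ` M i. m = a + b" by (auto simp: add)
  qed (use finite_degree_1 in \<open>auto simp: degree_0 zero\<close>)
  moreover have "card (\<phi> ` M i) = card (M i)" for i
    using inj by (intro card_image) (auto intro: inj_on_subset)
  ultimately show ?thesis
    unfolding realizable_def using f by (intro exI[of _ "\<lambda>i. \<phi> ` M i"]) simp
qed

text \<open>Variables of the first component are renamed to even indices and those of the second to
  odd ones, so that the two components can be separated again.\<close>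

lemma realizable_transport_pair:
  fixes M :: "nat \<Rightarrow> (nat multiset \<times> nat multiset) set"
  assumes "graded_monomials M"
    and "\<forall>\<^sub>F i in sequentially. int (card (M i)) = poly f (int i)"
  shows "realizable f"
proof (rule realizable_transport[OF assms(1) _ _ _ assms(2)])
  let ?\<phi> = "\<lambda>(a, b). image_mset (\<lambda>n. 2 * n) a + image_mset (\<lambda>n. 2 * n + 1) b :: nat multiset"
  let ?\<psi> = "\<lambda>m. (image_mset (\<lambda>n. n div 2) (filter_mset even m), image_mset (\<lambda>n. n div 2) (filter_mset odd m))"
  have "?\<psi> (?\<phi> p) = p" for p
    by (cases p) (simp add: filter_mset_image_mset multiset.map_comp comp_def)
  then show "inj ?\<phi>" by (rule inj_on_inverseI)
qed (auto simp: zero_prod_def)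

lemma realizable_add:
  assumes "realizable f" "realizable g"
  shows "realizable (f + g)"
proof -
  obtain M :: "nat \<Rightarrow> nat multiset set" where M: "graded_monomials M"
    and f: "\<forall>\<^sub>F i in sequentially. int (card (M i)) = poly f (int i)"
    using assms(1) by (auto simp: realizable_def)
  obtain N :: "nat \<Rightarrow> nat multiset set" where N: "graded_monomials N"
    and g: "\<forall>\<^sub>F i in sequentially. int (card (N i)) = poly g (int i)"
    using assms(2) by (auto simp: realizable_def)
  interpret M: graded_monomials M by fact
  interpret N: graded_monomials N by fact
  \<comment> \<open>A pair of bidegree \<open>(p, q)\<close> is kept only if \<open>p = 0\<close> or
    \<open>q = 0\<close>, so a product of monomials of positive degree from different sides
    vanishes. With explicit bidegrees the axioms can be checked coordinatewise.\<close>
  define L where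
    "L i = {(x, y). \<exists>p q. x \<in> M p \<and> y \<in> N q \<and> p + q = i \<and> (p = 0 \<or> q = 0)}" for i
  have mem_L: "m \<in> L i \<longleftrightarrow>
      (\<exists>p q. fst m \<in> M p \<and> snd m \<in> N q \<and> p + q = i \<and> (p = 0 \<or> q = 0))" for m i
    by (cases m) (simp add: L_def)
  have L: "L i = M i \<times> {0} \<union> {0} \<times> N i" for i
    unfolding L_def using M.degree_0 N.degree_0 by fastforce
  have "graded_monomials L"
  proof
    show "L 0 = {0}" by (auto simp: L M.degree_0 N.degree_0 zero_prod_def)
    show "finite (L 1)" using M.finite_degree_1 N.finite_degree_1 by (auto simp: L)
    fix i j k l a b c
    show "k = i + j" if ab: "a \<in> L i" "b \<in> L j" "a + b \<in> L k"
    proof -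
      from ab(1) obtain p q where 1: "fst a \<in> M p" "snd a \<in> N q" "p + q = i"
        by (auto simp: mem_L)
      from ab(2) obtain p' q' where 2: "fst b \<in> M p'" "snd b \<in> N q'" "p' + q' = j"
        by (auto simp: mem_L)
      from ab(3) obtain r t where 3: "fst (a + b) \<in> M r" "snd (a + b) \<in> N t" "r + t = k"
        by (auto simp: mem_L)
      have "r = p + p'" "t = q + q'"
        using M.degree_add[OF 1(1) 2(1)] N.degree_add[OF 1(2) 2(2)] 3(1,2) by simp_all
      then show ?thesis using 1(3) 2(3) 3(3) by simp
    qed
    show "a + b \<in> L (i + j)" if abc: "a \<in> L i" "b \<in> L j" "c \<in> L k" "a + b + c \<in> L l"
    proof -
      from abc(1) obtain p q where 1: "fst a \<in> M p" "snd a \<in> N q" "p + q = i"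
        by (auto simp: mem_L)
      from abc(2) obtain p' q' where 2: "fst b \<in> M p'" "snd b \<in> N q'" "p' + q' = j"
        by (auto simp: mem_L)
      from abc(3) obtain p'' q'' where 3: "fst c \<in> M p''" "snd c \<in> N q''"
        by (auto simp: mem_L)
      from abc(4) obtain r t where 4: "fst a + fst b + fst c \<in> M r" "snd a + snd b + snd c \<in> N t"
          "r = 0 \<or> t = 0"
        by (auto simp: mem_L)
      have 5: "fst a + fst b \<in> M (p + p')" "snd a + snd b \<in> N (q + q')"
        using M.divisor[OF 1(1) 2(1) 3(1) 4(1)] N.divisor[OF 1(2) 2(2) 3(2) 4(2)] by simp_all
      then have "r = p + p' + p''" "t = q + q' + q''"
        using M.degree_add[OF 5(1) 3(1) 4(1)] N.degree_add[OF 5(2) 3(2) 4(2)] by simp_all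
      \<comment> \<open>One coordinate of the threefold sum has degree zero, hence so does that
        coordinate of the partial sum.\<close>
      then have "p + p' = 0 \<or> q + q' = 0" using 4(3) by auto
      moreover have "(p + p') + (q + q') = i + j" using 1(3) 2(3) by simp
      ultimately show ?thesis
        using 5 unfolding mem_L fst_add snd_add by blast
    qed
  next
    fix i m assume "m \<in> L (Suc i)"
    then consider x where "m = (x, 0)" "x \<in> M (Suc i)" | x where "m = (0, x)" "x \<in> N (Suc i)"
      by (auto simp: L)
    then show "\<exists>a\<in>L 1. \<exists>b\<in>L i. m = a + b"
    proof cases
      case 1
      then obtain a b where "a \<in> M 1" "b \<in> M i" "x = a + b" using M.generated by blast
      with 1 show ?thesis
        by (intro bexI[of _ "(a, 0)"] bexI[of _ "(b, 0)"]) (auto simp: L)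
    next
      case 2
      then obtain a b where "a \<in> N 1" "b \<in> N i" "x = a + b" using N.generated by blast
      with 2 show ?thesis
        by (intro bexI[of _ "(0, a)"] bexI[of _ "(0, b)"]) (auto simp: L)
    qed
  qed
  moreover have "\<forall>\<^sub>F i in sequentially. int (card (L i)) = poly (f + g) (int i)"
    \<comment> \<open>The two halves of \<open>L i\<close> share the pair \<open>(0, 0)\<close> in
      degree zero; in positive degree they are disjoint.\<close>
    using f g eventually_gt_at_top[of 0]
  proof eventually_elim
    case (elim i)
    have "0 \<notin> M i"
      using M.degree_unique[of 0 i 0] M.degree_0 elim(3) by auto
    then have "card (L i) = card (M i \<times> {0::nat multiset}) + card ({0::nat multiset} \<times> N i)"
      unfolding L using M.finite_degree N.finite_degree
      by (intro card_Un_disjoint) auto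
    with elim show ?case by (simp add: card_cartesian_product)
  qed
  ultimately show ?thesis by (rule realizable_transport_pair)
qed

text \<open>In the Segre product both coordinates have the same degree \<open>i\<close>, so the
  axioms hold coordinatewise and cardinalities multiply.\<close>

lemma realizable_mult:
  assumes "realizable f" "realizable g"
  shows "realizable (f * g)"
proof -
  obtain M :: "nat \<Rightarrow> nat multiset set" where M: "graded_monomials M"
    and f: "\<forall>\<^sub>F i in sequentially. int (card (M i)) = poly f (int i)"
    using assms(1) by (auto simp: realizable_def)
  obtain N :: "nat \<Rightarrow> nat multiset set" where N: "graded_monomials N"
    and g: "\<forall>\<^sub>F i in sequentially. int (card (N i)) = poly g (int i)"
    using assms(2) by (auto simp: realizable_def)
  interpret M: graded_monomials M by fact
  interpret N: graded_monomials N by fact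
  have "graded_monomials (\<lambda>i. M i \<times> N i)"
  proof
    fix i j k l and a b c :: "nat multiset \<times> nat multiset"
    show "k = i + j" if "a \<in> M i \<times> N i" "b \<in> M j \<times> N j" "a + b \<in> M k \<times> N k"
      using that M.degree_add[of "fst a" i "fst b" j k] by auto
    show "a + b \<in> M (i + j) \<times> N (i + j)"
      if "a \<in> M i \<times> N i" "b \<in> M j \<times> N j" "c \<in> M k \<times> N k" "a + b + c \<in> M l \<times> N l"
      using that M.divisor[of "fst a" i "fst b" j "fst c" k l]
        N.divisor[of "snd a" i "snd b" j "snd c" k l] by auto
  next
    fix i and m :: "nat multiset \<times> nat multiset" assume "m \<in> M (Suc i) \<times> N (Suc i)"
    then obtain x y where "m = (x, y)" "x \<in> M (Suc i)" "y \<in> N (Suc i)" by auto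
    moreover obtain a b where "a \<in> M 1" "b \<in> M i" "x = a + b"
      using calculation M.generated by blast
    moreover obtain a' b' where "a' \<in> N 1" "b' \<in> N i" "y = a' + b'"
      using calculation N.generated by blast
    ultimately show "\<exists>a\<in>M 1 \<times> N 1. \<exists>b\<in>M i \<times> N i. m = a + b"
      by (intro bexI[of _ "(a, a')"] bexI[of _ "(b, b')"]) auto
  qed (use M.finite_degree_1 N.finite_degree_1 in \<open>auto simp: M.degree_0 N.degree_0 zero_prod_def\<close>)
  moreover have "\<forall>\<^sub>F i in sequentially. int (card (M i \<times> N i)) = poly (f * g) (int i)"
    using f g by eventually_elim (simp add: card_cartesian_product)
  ultimately show ?thesis by (rule realizable_transport_pair)
qed

section \<open>Constant and linear building blocks\<close>

text \<open>The polynomial ring in one variable has exactly one monomial in each degree.\<close>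

lemma realizable_1: "realizable 1"
proof (rule realizable_transport)
  show "graded_monomials (\<lambda>i. {i :: nat})" by standard auto
  show "inj (\<lambda>n. replicate_mset n (0 :: nat))"
    by (rule inj_on_inverseI[where g = size]) simp
qed (auto intro!: multiset_eqI)

lemma realizable_power: "realizable f \<Longrightarrow> realizable (f ^ n)"
  by (induction n) (auto intro: realizable_1 realizable_mult)

lemma realizable_smult:
  assumes "realizable f" "0 < n"
  shows "realizable (smult (int n) f)"
  using assms(2)
proof (induction n rule: nat_induct_non_zero)
  case (Suc n)
  then show ?case
    using realizable_add[OF assms(1)] by (simp add: smult_add_left)
qed (use assms(1) in simp)

text \<open>
  The triple \<open>(j, a, c)\<close> in the proof stands for the monomial \<open>x^(j - a - c) y^a z^c\<close> modulo \<open>z^(2k+3)\<close>.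
\<close>

lemma realizable_linear: "realizable [:- int ((2 * k + 3) * k), int (2 * k + 3):]"
proof (rule realizable_transport)
  let ?m = "2 * k + 3"
  let ?M = "\<lambda>i. {(j, a, c). j = i \<and> c < ?m \<and> a + c \<le> i}"
  show "graded_monomials ?M"
  proof
    have "?M 1 \<subseteq> {..1} \<times> {..1} \<times> {..1}" by auto
    then show "finite (?M 1)" by (rule finite_subset) auto
  next
    fix i m assume "m \<in> ?M (Suc i)"
    then obtain a c where m: "m = (Suc i, a, c)" "c < ?m" "a + c \<le> Suc i" by auto
    \<comment> \<open>Split off \<open>y\<close> if it occurs, otherwise \<open>z\<close> if it
      occurs, otherwise \<open>x\<close>.\<close>
    consider "a > 0" | "a = 0" "c > 0" | "a = 0" "c = 0" by auto
    then show "\<exists>a\<in>?M 1. \<exists>b\<in>?M i. m = a + b"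
    proof cases
      case 1
      with m show ?thesis
        by (intro bexI[of _ "(1, 1, 0)"] bexI[of _ "(i, a - 1, c)"]) auto
    next
      case 2
      with m show ?thesis
        by (intro bexI[of _ "(1, 0, 1)"] bexI[of _ "(i, 0, c - 1)"]) auto
    next
      case 3
      with m show ?thesis
        by (intro bexI[of _ "(1, 0, 0)"] bexI[of _ "(i, 0, 0)"]) auto
    qed
  qed (auto simp: zero_prod_def)
  \<comment> \<open>Variable 0 records the total degree \<open>j\<close>, not the exponent of
    \<open>x\<close>; the map is still additive and injective.\<close>
  let ?\<phi> = "\<lambda>(j, a, c). replicate_mset j 0 + replicate_mset a 1 + replicate_mset c 2 :: nat multiset"
  have "(\<lambda>m. (count m 0, count m 1, count m 2)) (?\<phi> p) = p" for p
    by (cases p) auto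
  then show "inj ?\<phi>" by (rule inj_on_inverseI)
  show "?\<phi> (p + q) = ?\<phi> p + ?\<phi> q" for p q
    by (cases p; cases q) (auto intro!: multiset_eqI)
  show "?\<phi> 0 = 0" by (simp add: zero_prod_def)
  \<comment> \<open>For a fixed exponent \<open>c\<close> of \<open>z\<close> there are
    \<open>i - c + 1\<close> choices of \<open>a\<close>; doubling avoids a division. At
    \<open>n = 2k+3\<close> the right-hand side is \<open>2(2k+3)(i - k)\<close>.\<close>
  have sum: "2 * (\<Sum>c<n. int (Suc (i - c))) = int n * (2 * int i + 3 - int n)" if "n \<le> i" for n i
    using that by (induction n) (auto simp: algebra_simps of_nat_diff)
  show "\<forall>\<^sub>F i in sequentially. int (card (?M i)) = poly [:- int (?m * k), int ?m:] (int i)"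
    using eventually_ge_at_top[of ?m]
  proof eventually_elim
    case (elim i)
    have "?M i = (\<lambda>(c, a). (i, a, c)) ` (SIGMA c:{..<?m}. {..i - c})"
      using elim by (auto simp: image_iff)
    then have "card (?M i) = card (SIGMA c:{..<?m}. {..i - c})"
      by (simp add: card_image inj_on_def)
    then have "2 * int (card (?M i)) = int ?m * (2 * int i + 3 - int ?m)"
      using sum[OF elim] by simp
    then show ?case by (simp add: algebra_simps)
  qed
qed

section \<open>Prescribing the signs of the coefficients\<close>

text \<open>Signs are appended at the end of the list, because each step alters the former leading
  coefficient and only rescales those below it. A positive integer leading coefficient is at least
  1, hence at least the new sign, and so \<open>k\<close> in the induction step is a true
  difference.\<close>

lemma exists_realizable_with_signs:
  fixes s :: "int list"
  assumes "set s \<subseteq> {-1, 0, 1}"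
  shows "\<exists>f. realizable f \<and> degree f = length s \<and> 0 < lead_coeff f \<and>
    (\<forall>i<length s. sgn (coeff f i) = s ! i)"
  using assms
proof (induction s rule: rev_induct)
  case Nil
  then show ?case by (intro exI[of _ 1]) (simp add: realizable_1)
next
  case (snoc x s)
  then obtain f where f: "realizable f" "degree f = length s" "0 < lead_coeff f"
    "\<And>i. i < length s \<Longrightarrow> sgn (coeff f i) = s ! i"
    by auto
  define n where "n = length s"
  define k where "k = nat (lead_coeff f - x)"
  define c where "c = 2 * k + 3"
  \<comment> \<open>The scalar on \<open>f\<close> equals the leading coefficient of the product, so
    at \<open>x^n\<close> the two contributions combine to
    \<open>3 ^ n * c * (lead_coeff f - k)\<close>, which is \<open>3 ^ n * c * x\<close> for the new
    sign \<open>x\<close>.\<close>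
  define g where "g = [:0, 3:] ^ n * [:- int (c * k), int c:] + smult (int (3 ^ n * c)) f"
  have x: "x \<in> {-1, 0, 1}" using snoc.prems by simp
  then have k: "int k = lead_coeff f - x" using f(3) by (auto simp: k_def)
  have "realizable [:0, 3:]" using realizable_linear[of 0] by simp
  then have "realizable g"
    unfolding g_def c_def
    by (intro realizable_add realizable_mult realizable_power realizable_linear realizable_smult f) auto
  have "[:0, 3:] ^ n = monom (3 ^ n :: int) n"
    by (metis monom_power mult_1 monom_0 monom_Suc One_nat_def)
  then have coeff_g: "coeff g i = (if i < n then 0 else 3 ^ n * coeff [:- int (c * k), int c:] (i - n))
      + int (3 ^ n * c) * coeff f i" for i
    by (simp only: g_def coeff_add coeff_smult coeff_monom_mult)
  have beyond: "coeff g i = 0" if "i > Suc n" for i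
  proof -
    have "i = n + Suc (Suc (i - n - 2))" using that by simp
    then have "i - n = Suc (Suc (i - n - 2))" by simp
    then have "coeff [:- int (c * k), int c:] (i - n) = 0" by (metis coeff_pCons_Suc coeff_0)
    then show ?thesis using that f(2) by (simp add: coeff_g n_def coeff_eq_0)
  qed
  have lead: "coeff g (Suc n) = 3 ^ n * int c"
    using f(2) by (simp add: coeff_g n_def coeff_eq_0)
  have "0 < c" by (simp add: c_def)
  then have "0 < 3 ^ n * int c" by simp
  then have "degree g = Suc n"
    using lead beyond \<open>0 < c\<close> by (intro antisym degree_le le_degree) auto
  moreover have "sgn (coeff g i) = (s @ [x]) ! i" if "i < Suc n" for i
  proof (cases "i = n")
    case True
    have "coeff f n = int k + x"
      using f(2) k by (simp add: n_def)
    then have "coeff g n = (3 ^ n * int c) * x"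
      by (simp add: coeff_g algebra_simps)
    then show ?thesis
      using x \<open>0 < 3 ^ n * int c\<close> True by (auto simp: sgn_mult n_def)
  next
    case False
    then have "i < n" using that by simp
    then show ?thesis
      using f(4) \<open>0 < c\<close> by (simp add: coeff_g sgn_mult n_def nth_append)
  qed
  ultimately show ?case
    using \<open>realizable g\<close> lead \<open>0 < 3 ^ n * int c\<close> by (intro exI[of _ g]) (simp add: n_def)
qed

theorem corollary2:
  fixes K :: "('a, 'm) ring_scheme" and d :: nat and s :: "int list"
  assumes "field K" and "d \<ge> 1" and "length s = d" and "set s \<subseteq> {-1, 0, 1}"
  shows "\<exists>f :: int poly. is_hilbert_polynomial K (map_poly rat_of_int f) \<and> degree f = d \<and> sign_vector f = s"
proof -
  obtain f where f: "realizable f" "degree f = length s"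
    "\<And>i. i < length s \<Longrightarrow> sgn (coeff f i) = s ! i"
    using exists_realizable_with_signs[OF assms(4)] by blast
  have "sign_vector f = s"
    using f(2,3) by (intro nth_equalityI) (auto simp: sign_vector_def)
  with f(1,2) assms(1,3) show ?thesis
    using realizable_imp_is_hilbert_polynomial by blast
qed

end
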